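(* Let $a>0$ be a real number, let $g_0$ be the standard Euclidean metric on $\mathbf{R}^4$ and let $g_a$ be the Hawking Taub-NUT metric on $\mathbf{R}^4$. Let $X=X^i\frac{\partial}{\partial x^i}$ be a Killing vector field on $(\mathbf{R}^4,g_0)$, written as $X^i=\sum_{j=1}^4 Q^i_j x^j+C^i$ with $(Q^i_j)$ a constant anti-symmetric real $4\times 4$ matrix ($i$ the row index, $j$ the column index) and $(C^i)$ a constant vector in $\mathbf{R}^4$. Then $X$ is a Killing vector field on $(\mathbf{R}^4,g_a)$ if and only if $(C^i)=(0)$ and the matrix $(Q^i_j)$ is of the form $$\begin{pmatrix} 0 & m & s & r\\ -m & 0 & -r & s\\ -s & r & 0 & n\\ -r & -s & -n & 0\end{pmatrix},$$ where $m$, $n$, $r$ and $s$ are constant real numbers.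
   Context: Let $x=(x^1,x^2,x^3,x^4)$ denote the standard coordinates on $\mathbf{R}^4$ (superscripts are indices) and $|x|$ the Euclidean norm. For $a>0$, the Hawking Taub-NUT metric on $\mathbf{R}^4$ is the Riemannian metric $$g_a=(a|x|^2+1)\,g_0-\frac{a(a|x|^2+2)}{a|x|^2+1}\,\omega^2,$$ where $g_0=\sum_{i=1}^4 (dx^i)^2$ and $\omega$ is the 1-form $\omega=-x^2dx^1+x^1dx^2-x^4dx^3+x^3dx^4$ (here $\omega^2=\omega\otimes\omega$). A vector field $X$ is a Killing vector field of a Riemannian metric $g$ if $\mathcal{L}_X g=0$. The Killing vector fields of $(\mathbf{R}^4,g_0)$ are exactly the vector fields with components $X^i=\sum_j Q^i_jx^j+C^i$ with $(Q^i_j)$ a constant anti-symmetric matrix and $(C^i)$ a constant vector. *)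

theory Defs
  imports "HOL-Analysis.Analysis"
begin

type_synonym 'n vfield = "real^'n \<Rightarrow> real^'n"

text \<open>A (0,2)-tensor field on \<open>R^n\<close>, given by its value at a point on two tangent vectors;
  all tangent spaces are identified with \<open>R^n\<close> through the standard coordinates.\<close>
type_synonym 'n tensor2 = "real^'n \<Rightarrow> real^'n \<Rightarrow> real^'n \<Rightarrow> real"

primrec Ck :: "nat \<Rightarrow> (real^'n::finite \<Rightarrow> real) \<Rightarrow> bool" where
  "Ck 0 f \<longleftrightarrow> continuous_on UNIV f"
| "Ck (Suc k) f \<longleftrightarrow> f differentiable_on UNIV \<and>
     (\<forall>i. Ck k (\<lambda>p. frechet_derivative f (at p) (axis i 1)))"

definition smooth_vfield :: "'n::finite vfield \<Rightarrow> bool" where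
  "smooth_vfield X \<longleftrightarrow> (\<forall>i k. Ck k (\<lambda>p. X p $ i))"

text \<open>In coordinates \<open>[X,Y]^i = X^j d_j Y^i - Y^j d_j X^i\<close>.\<close>
definition lie_bracket :: "'n::finite vfield \<Rightarrow> 'n vfield \<Rightarrow> 'n vfield" where
  "lie_bracket X Y p = frechet_derivative Y (at p) (X p) - frechet_derivative X (at p) (Y p)"

text \<open>The invariant formula \<open>(L_X g)(Y,Z) = X(g(Y,Z)) - g([X,Y],Z) - g(Y,[X,Z])\<close>.\<close>
definition lie_derivative ::
    "'n::finite vfield \<Rightarrow> 'n tensor2 \<Rightarrow> 'n vfield \<Rightarrow> 'n vfield \<Rightarrow> real^'n \<Rightarrow> real" where
  "lie_derivative X g Y Z p =
     frechet_derivative (\<lambda>q. g q (Y q) (Z q)) (at p) (X p)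
     - g p (lie_bracket X Y p) (Z p) - g p (Y p) (lie_bracket X Z p)"

text \<open>Intended for smooth \<open>g\<close>: otherwise the derivative of \<open>g(Y,Z)\<close> need not exist.\<close>
definition killing_field :: "'n::finite tensor2 \<Rightarrow> 'n vfield \<Rightarrow> bool" where
  "killing_field g X \<longleftrightarrow> smooth_vfield X \<and>
     (\<forall>Y Z p. smooth_vfield Y \<longrightarrow> smooth_vfield Z \<longrightarrow> lie_derivative X g Y Z p = 0)"

definition flat_metric :: "'n::finite tensor2" where
  "flat_metric p v w = v \<bullet> w"

text \<open>The index type \<^typ>\<open>4\<close> has exactly the elements \<open>1, 2, 3, 4\<close> (with \<open>4 = 0\<close>).\<close>
definition taub_nut_form :: "real^4 \<Rightarrow> real^4 \<Rightarrow> real" where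
  "taub_nut_form x v = - x$2 * v$1 + x$1 * v$2 - x$4 * v$3 + x$3 * v$4"

definition taub_nut_metric :: "real \<Rightarrow> 4 tensor2" where
  "taub_nut_metric a x v w =
     (a * (norm x)\<^sup>2 + 1) * flat_metric x v w
     - a * (a * (norm x)\<^sup>2 + 2) / (a * (norm x)\<^sup>2 + 1) * (taub_nut_form x v * taub_nut_form x w)"

end

theory Submission imports Defs
begin

text \<open>Write \<open>\<omega> = taub_nut_form\<close>, \<open>\<alpha> = a|p|\<^sup>2 + 1\<close> and \<open>\<beta> = a(\<alpha> + 1)/\<alpha>\<close>, so that the metric is
  \<open>\<alpha> g\<^sub>0 - \<beta> \<omega>\<^sup>2\<close>. For \<open>X p = Q p + C\<close> with \<open>Q\<close> antisymmetric, \<open>X\<close> differentiates \<open>\<alpha>\<close> and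
  \<open>\<beta>\<close> to multiples of \<open>p \<bullet> C\<close>. Evaluating the Lie derivative at \<open>p = C\<close> on \<open>(C, C)\<close>, where
  \<open>\<omega>\<close> vanishes, leaves \<open>2a|C|\<^sup>4\<close>, so \<open>C = 0\<close>. The Lie derivative is then
  \<open>-\<beta>\<close> times the symmetric product of \<open>\<omega>\<close> and \<open>L\<^sub>X \<omega>\<close>, which vanishes if and only if
  \<open>L\<^sub>X \<omega> = 0\<close>, i.e. if and only if \<open>Q\<close> commutes with the complex structure representing \<open>\<omega>\<close>.\<close>

lemma Ck_const: "Ck k (\<lambda>p::real^'n::finite. c)"
  by (induction k arbitrary: c) simp_all

lemma smooth_vfield_const: "smooth_vfield (\<lambda>p::real^'n::finite. v)"
  by (simp add: smooth_vfield_def Ck_const)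

text \<open>Lie derivatives are written with \<open>frechet_derivative\<close>, which is meaningful
  only where a derivative exists; \<open>Ck\<close> at order one supplies it for each
  component.\<close>

lemma smooth_vfield_differentiable:
  fixes Y :: "'n::finite vfield"
  assumes "smooth_vfield Y"
  shows "Y differentiable (at p)"
proof -
  have "(\<lambda>q. Y q $ i) differentiable (at p)" for i
  proof -
    have "Ck (Suc 0) (\<lambda>q. Y q $ i)"
      using assms unfolding smooth_vfield_def by blast
    then show ?thesis
      by (simp add: differentiable_on_def)
  qed
  then show ?thesis
    by (subst differentiable_componentwise_within)
       (auto simp: Basis_vec_def inner_axis)
qed

lemma bounded_bilinear_taub_nut_form: "bounded_bilinear taub_nut_form"
proof -
  have "bilinear taub_nut_form"
    unfolding bilinear_def taub_nut_form_def
    by (auto intro!: linearI simp: algebra_simps)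
  then show ?thesis
    by (simp add: bilinear_conv_bounded_bilinear)
qed

text \<open>By the Leibniz rule the derivatives of \<open>Y\<close> and \<open>Z\<close> cancel
  against the brackets, so only their values at \<open>p\<close> remain. \<open>\<theta>\<close> is
  \<open>L_X \<omega>\<close> at \<open>p\<close>, the second term comes from differentiating
  \<beta>, and the last is \<alpha> times \<open>L_X g_0\<close>.\<close>

lemma lie_derivative_taub_nut:
  fixes X Y Z :: "4 vfield" and p :: "real^4"
  assumes X: "(X has_derivative X') (at p)"
    and Y: "Y differentiable (at p)" and Z: "Z differentiable (at p)"
    and a: "a > 0"
  defines "\<alpha> \<equiv> a * (norm p)\<^sup>2 + 1"
  defines "\<theta> \<equiv> \<lambda>v. taub_nut_form (X p) v + taub_nut_form p (X' v)"
  shows "lie_derivative X (taub_nut_metric a) Y Z p =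
    2 * a * (p \<bullet> X p) * (Y p \<bullet> Z p)
    + 2 * a\<^sup>2 * (p \<bullet> X p) / \<alpha>\<^sup>2 * (taub_nut_form p (Y p) * taub_nut_form p (Z p))
    - a * (\<alpha> + 1) / \<alpha> * (\<theta> (Y p) * taub_nut_form p (Z p) + taub_nut_form p (Y p) * \<theta> (Z p))
    + \<alpha> * (X' (Y p) \<bullet> Z p + Y p \<bullet> X' (Z p))"
proof -
  obtain Y' Z' where Y': "(Y has_derivative Y') (at p)" and Z': "(Z has_derivative Z') (at p)"
    using Y Z unfolding differentiable_def by blast
  note FD = frechet_derivative_at[OF X, symmetric] frechet_derivative_at[OF Y', symmetric]
    frechet_derivative_at[OF Z', symmetric]
  note deriv = bounded_bilinear.FDERIV[OF bounded_bilinear_taub_nut_form]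
  have pos: "a * (norm q)\<^sup>2 + 1 > 0" for q :: "real^4"
    using a by (simp add: add_nonneg_pos)
  then have \<alpha>: "\<alpha> \<noteq> 0" unfolding \<alpha>_def by (metis less_irrefl)
  define \<alpha>' where "\<alpha>' = (\<lambda>h. 2 * a * (p \<bullet> h))"
  have D\<alpha>: "((\<lambda>q. a * (norm q)\<^sup>2 + 1) has_derivative \<alpha>') (at p)"
    unfolding power2_norm_eq_inner \<alpha>'_def
    by (auto intro!: derivative_eq_intros simp: inner_commute algebra_simps)
  have D\<beta>: "((\<lambda>q. a * (a * (norm q)\<^sup>2 + 2) / (a * (norm q)\<^sup>2 + 1)) has_derivative
      (\<lambda>h. - a * \<alpha>' h / \<alpha>\<^sup>2)) (at p)"
  proof -
    \<comment> \<open>In the form \<open>\<beta> = a + a / \<alpha>\<close> only a reciprocal has to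
      be differentiated.\<close>
    have eq: "(\<lambda>q::real^4. a * (a * (norm q)\<^sup>2 + 2) / (a * (norm q)\<^sup>2 + 1))
        = (\<lambda>q. a + a * inverse (a * (norm q)\<^sup>2 + 1))"
    proof
      fix q :: "real^4"
      have "a * (norm q)\<^sup>2 + 1 \<noteq> 0" using pos[of q] by linarith
      then show "a * (a * (norm q)\<^sup>2 + 2) / (a * (norm q)\<^sup>2 + 1)
          = a + a * inverse (a * (norm q)\<^sup>2 + 1)"
        by (simp add: field_simps)
    qed
    show ?thesis
      unfolding eq
      by (rule has_derivative_eq_rhs[OF has_derivative_add[OF has_derivative_const
              has_derivative_mult_right[OF Deriv.has_derivative_inverse[OF \<alpha>[unfolded \<alpha>_def] D\<alpha>]]]])
         (simp add: \<alpha>_def power2_eq_square divide_inverse ac_simps)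
  qed
  have D\<omega>Y: "((\<lambda>q. taub_nut_form q (Y q)) has_derivative
      (\<lambda>h. taub_nut_form p (Y' h) + taub_nut_form h (Y p))) (at p)"
    by (rule deriv[OF has_derivative_ident Y'])
  have D\<omega>Z: "((\<lambda>q. taub_nut_form q (Z q)) has_derivative
      (\<lambda>h. taub_nut_form p (Z' h) + taub_nut_form h (Z p))) (at p)"
    by (rule deriv[OF has_derivative_ident Z'])
  note D = has_derivative_diff[OF
      has_derivative_mult[OF D\<alpha> has_derivative_inner[OF Y' Z']]
      has_derivative_mult[OF D\<beta> has_derivative_mult[OF D\<omega>Y D\<omega>Z]]]
  have \<alpha>1: "a * (norm p)\<^sup>2 + 2 = \<alpha> + 1" and \<alpha>2: "a * (norm p)\<^sup>2 + 1 = \<alpha>"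
    by (simp_all add: \<alpha>_def)
  have \<omega>diff: "taub_nut_form p (u - v) = taub_nut_form p u - taub_nut_form p v" for u v
    by (rule bounded_bilinear.diff_right[OF bounded_bilinear_taub_nut_form])
  define \<beta> where "\<beta> = a * (\<alpha> + 1) / \<alpha>"
  show ?thesis
    unfolding lie_derivative_def lie_bracket_def taub_nut_metric_def flat_metric_def FD
      frechet_derivative_at[OF D, symmetric] \<omega>diff \<alpha>1 \<alpha>2
    unfolding \<beta>_def[symmetric]
    by (simp add: \<alpha>'_def \<theta>_def inner_diff_left inner_diff_right algebra_simps power2_eq_square)
qed

text \<open>Taking both arguments equal to \<open>u\<close> gives \<open>2 * f u * h u = 0\<close>,
  hence \<open>f u = 0\<close>; taking only the second equal to \<open>u\<close> then leaves
  \<open>f v * h u = 0\<close>.\<close>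

lemma symmetric_product_eq_0:
  fixes f h :: "'a \<Rightarrow> 'b::{idom, ring_char_0}"
  assumes "\<And>v w. f v * h w + h v * f w = 0" and "h u \<noteq> 0"
  shows "f v = 0"
proof -
  have "2 * (f u * h u) = 0"
    using assms(1)[of u u] by (simp add: algebra_simps)
  then have "f u = 0" using assms(2) by simp
  then show ?thesis using assms(1)[of v u] assms(2) by simp
qed

lemma antisymmetric_inner_matrix_mult:
  fixes Q :: "real^'n^'n"
  assumes "transpose Q = - Q"
  shows "(Q *v v) \<bullet> w = - (v \<bullet> (Q *v w))"
proof -
  have "v v* Q = - (Q *v v)"
    using transpose_matrix_vector[of Q v] assms
    by (simp add: matrix_vector_mult_def vec_eq_iff sum_negf)
  then show ?thesis
    using dot_lmul_matrix[of v Q w] by simp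
qed

lemma vector_4 [simp]:
  "(vector [w, x, y, z] :: 'a::zero^4) $ 1 = w"
  "(vector [w, x, y, z] :: 'a::zero^4) $ 2 = x"
  "(vector [w, x, y, z] :: 'a::zero^4) $ 3 = y"
  "(vector [w, x, y, z] :: 'a::zero^4) $ 4 = z"
  unfolding vector_def by simp_all

lemma taub_nut_form_self: "taub_nut_form p p = 0"
  by (simp add: taub_nut_form_def)

lemma taub_nut_form_nondegenerate:
  assumes "p \<noteq> 0"
  shows "\<exists>u. taub_nut_form p u \<noteq> 0"
proof
  \<comment> \<open>The witness is \<open>J p\<close>, where \<open>J\<close> is the complex
    structure with \<open>\<omega> p v = J p \<bullet> v\<close>.\<close>
  have "taub_nut_form p (vector [- p$2, p$1, - p$4, p$3]) = p \<bullet> p"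
    by (simp add: taub_nut_form_def inner_vec_def sum_4)
  then show "taub_nut_form p (vector [- p$2, p$1, - p$4, p$3]) \<noteq> 0"
    using assms by simp
qed

text \<open>The left-hand side says that \<open>L\<^sub>X \<omega> = 0\<close> for the linear field \<open>X p = Q p\<close>.\<close>

lemma taub_nut_form_invariant_iff:
  fixes Q :: "real^4^4"
  assumes "transpose Q = - Q"
  shows "(\<forall>p v. taub_nut_form (Q *v p) v + taub_nut_form p (Q *v v) = 0) \<longleftrightarrow>
    (\<exists>m n r s :: real.
      Q = vector [vector [  0,   m,   s, r],
                  vector [- m,   0, - r, s],
                  vector [- s,   r,   0, n],
                  vector [- r, - s, - n, 0]])" (is "?L \<longleftrightarrow> ?R")
proof
  assume L: ?L
  have anti: "Q$i$j = - Q$j$i" for i j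
    using arg_cong[OF assms, of "\<lambda>A. A$j$i"] by (simp add: transpose_def)
  have diag: "Q$i$i = 0" for i
    using anti[of i i] by simp
  note inv = L[rule_format, of "axis _ 1" "axis _ 1",
      unfolded taub_nut_form_def matrix_vector_mult_basis column_def vec_lambda_beta]
  \<comment> \<open>Beyond antisymmetry, invariance only forces the upper right 2x2 block to be
    complex linear; basis vectors 1, 4 and 1, 3 give these two equations.\<close>
  have "Q$2$4 = Q$1$3" "Q$2$3 = - (Q$1$4)"
    using inv[of 1 4] inv[of 1 3] anti[of 1 3] anti[of 1 4]
    by (simp_all add: axis_def)
  then have "Q = vector [vector [0, Q$1$2, Q$1$3, Q$1$4],
                  vector [- (Q$1$2), 0, - (Q$1$4), Q$1$3],
                  vector [- (Q$1$3), Q$1$4, 0, Q$3$4],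
                  vector [- (Q$1$4), - (Q$1$3), - (Q$3$4), 0]]"
    using anti[of 2 1] anti[of 3 1] anti[of 4 1] anti[of 3 2] anti[of 4 2] anti[of 4 3]
    by (simp add: vec_eq_iff forall_4 diag)
  then show ?R by blast
next
  assume ?R
  then show ?L
    by (auto simp: taub_nut_form_def matrix_vector_mult_def sum_4 algebra_simps)
qed

theorem theorem3p2:
  fixes a :: real and X :: "real^4 \<Rightarrow> real^4" and Q :: "real^4^4" and C :: "real^4"
  assumes "a > 0"
    and "killing_field flat_metric X"
    and "transpose Q = - Q"
    and "\<And>x i. X x $ i = (\<Sum>j\<in>UNIV. Q $ i $ j * x $ j) + C $ i"
  shows "killing_field (taub_nut_metric a) X \<longleftrightarrow>
    C = 0 \<and>
    (\<exists>m n r s :: real.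
      Q = vector [vector [  0,   m,   s, r],
                  vector [- m,   0, - r, s],
                  vector [- s,   r,   0, n],
                  vector [- r, - s, - n, 0]])"
proof -
  have X: "X = (\<lambda>p. Q *v p + C)"
    using assms(4) by (auto simp: fun_eq_iff vec_eq_iff matrix_vector_mult_def)
  have smooth: "smooth_vfield X"
    using assms(2) by (simp add: killing_field_def)
  have DX: "(X has_derivative (\<lambda>h. Q *v h)) (at p)" for p
    unfolding X by (auto intro!: derivative_eq_intros bounded_linear_imp_has_derivative)
  have anti: "(Q *v v) \<bullet> w = - (v \<bullet> (Q *v w))" for v w
    by (rule antisymmetric_inner_matrix_mult[OF assms(3)])
  have "p \<bullet> (Q *v p) = 0" for p
    using anti[of p p] by (simp add: inner_commute)
  then have radial: "p \<bullet> X p = p \<bullet> C" for p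
    by (simp add: X inner_add_right)
  define \<theta> where "\<theta> p v = taub_nut_form (X p) v + taub_nut_form p (Q *v v)" for p v
  define \<alpha> where "\<alpha> p = a * (norm p)\<^sup>2 + 1" for p :: "real^4"
  \<comment> \<open>The \<open>L_X g_0\<close> term drops out by antisymmetry of
    \<open>Q\<close>.\<close>
  have lie: "lie_derivative X (taub_nut_metric a) Y Z p =
      2 * a * (p \<bullet> C) * (Y p \<bullet> Z p)
      + 2 * a\<^sup>2 * (p \<bullet> C) / (\<alpha> p)\<^sup>2 * (taub_nut_form p (Y p) * taub_nut_form p (Z p))
      - a * (\<alpha> p + 1) / \<alpha> p *
        (\<theta> p (Y p) * taub_nut_form p (Z p) + taub_nut_form p (Y p) * \<theta> p (Z p))"
    if "smooth_vfield Y" "smooth_vfield Z" for Y Z p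
    using lie_derivative_taub_nut[OF DX smooth_vfield_differentiable[OF that(1)]
        smooth_vfield_differentiable[OF that(2)] assms(1), of p]
    by (simp add: anti radial \<theta>_def \<alpha>_def)
  have pos: "\<alpha> p > 0" for p
    unfolding \<alpha>_def using assms(1) by (simp add: add_nonneg_pos)
  have \<theta>: "(\<forall>p v. \<theta> p v = 0) \<longleftrightarrow> (\<exists>m n r s :: real.
      Q = vector [vector [  0,   m,   s, r],
                  vector [- m,   0, - r, s],
                  vector [- s,   r,   0, n],
                  vector [- r, - s, - n, 0]])" if "C = 0"
    using taub_nut_form_invariant_iff[OF assms(3)] that by (simp add: \<theta>_def X)
  have "C = 0 \<and> (\<forall>p v. \<theta> p v = 0)" if "killing_field (taub_nut_metric a) X"
  proof -
    \<comment> \<open>Constant fields realise every pair of tangent vectors at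
      \<open>p\<close>.\<close>
    have kill: "2 * a * (p \<bullet> C) * (v \<bullet> w)
      + 2 * a\<^sup>2 * (p \<bullet> C) / (\<alpha> p)\<^sup>2 * (taub_nut_form p v * taub_nut_form p w)
      - a * (\<alpha> p + 1) / \<alpha> p * (\<theta> p v * taub_nut_form p w + taub_nut_form p v * \<theta> p w) = 0" for p v w
      using that lie[OF smooth_vfield_const smooth_vfield_const, of v w p]
      by (simp add: killing_field_def smooth_vfield_const)
    have C: "C = 0"
      using kill[of C C C] assms(1) by (simp add: taub_nut_form_self)
    have nz: "a * (\<alpha> p + 1) / \<alpha> p \<noteq> 0" for p
      using assms(1) pos[of p] by simp
    have prod: "\<theta> p v * taub_nut_form p w + taub_nut_form p v * \<theta> p w = 0" for p v w
      using kill[of p v w] nz[of p] unfolding C by simp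
    \<comment> \<open>The origin is treated apart: \<omega> vanishes there, but so does
      \<open>X\<close> once \<open>C = 0\<close>.\<close>
    have "\<theta> p v = 0" for p v
    proof (cases "p = 0")
      case True
      then show ?thesis by (simp add: \<theta>_def X C taub_nut_form_def)
    next
      case False
      then obtain u where "taub_nut_form p u \<noteq> 0"
        using taub_nut_form_nondegenerate by blast
      then show ?thesis using symmetric_product_eq_0 prod by metis
    qed
    with C show ?thesis by blast
  qed
  moreover have "killing_field (taub_nut_metric a) X" if "C = 0" "\<forall>p v. \<theta> p v = 0"
    using smooth lie that by (simp add: killing_field_def)
  ultimately show ?thesis using \<theta> by metis
qed

end
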